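(* Let $G$ be a Lie group acting smoothly on a manifold $\mathcal M$. Suppose that the action is free and regular in a neighborhood of a point $\boldsymbol x_0\in\mathcal M$ and that there exists a right moving frame $\rho:\mathcal M\to G$ defined in this neighborhood. Then: (i) For any $f\in\mathcal F(\mathcal M)^\times$, the function $$\mu(g,\boldsymbol x)=\frac{f(g\cdot\boldsymbol x)}{f(\boldsymbol x)}$$ is a multiplier, i.e. a $1$-cocycle: $d^1\mu=1$. (ii) For every multiplier $\mu$ there exists $f\in\mathcal F(\mathcal M)^\times$ such that $$\mu(g,\boldsymbol x)=\frac{f(g\cdot\boldsymbol x)}{f(\boldsymbol x)}.$$
   Context: Write $\mathbb R^\times=\mathbb R\setminus\{0\}$, and identify points of $\mathcal M$ with their coordinates in a chosen local chart. $\mathcal F(\mathcal M)$ is the field of rational functions on $\mathcal M$, and $\mathcal F(\mathcal M)^\times$ is the multiplicative abelian group of nowhere-vanishing functions in it. The action is free if all stabilizers $G_{\boldsymbol x}=\{g\in G: g\cdot\boldsymbol x=\boldsymbol x\}$ are trivial. It is regular if all orbits have the same dimension and every point has arbitrarily small neighborhoods whose intersection with each orbit is a connected subset of that orbit. A right moving frame is a smooth map $\rho:\mathcal M\to G$ with $\rho(g\cdot\boldsymbol x)=\rho(\boldsymbol x)g^{-1}$ for all $g\in G$ and $\boldsymbol x$. A multiplier is a function $\mu:G\times\mathcal M\to\mathbb R^\times$ satisfying $$\mu(gh,\boldsymbol x)=\mu(g,h\cdot\boldsymbol x)\,\mu(h,\boldsymbol x),\qquad \mu(e,\boldsymbol x)=1,$$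 for all $g,h\in G$, $\boldsymbol x\in\mathcal M$. For a function $c:G\times\mathcal M\to\mathbb R^\times$ put $$(d^1c)(g_1,g_2,\boldsymbol x)=\frac{c(g_1,g_2\cdot\boldsymbol x)\,c(g_2,\boldsymbol x)}{c(g_1g_2,\boldsymbol x)};$$ $c$ is a $1$-cocycle if $d^1c=1$ identically. Standing conventions: everything takes place in the class of rational functions, that is, multipliers are rational functions of the group parameters and the coordinates, and the group parameters of $\rho(\boldsymbol x)$ are rational functions of $\boldsymbol x$. Moving frames are local objects: $\mathcal M$ stands for the neighborhood on which $\rho$ is defined, and all identities are understood for those $g$ and $\boldsymbol x$ for which both sides are defined. *)

theory Defs
  imports "HOL-Analysis.Analysis" "HOL-Algebra.Group_Action"
begin

section \<open>Smooth maps between open sets\<close>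

text \<open>Meant for open \<open>S\<close> and finite-dimensional domains, where \<open>C_on k\<close> is the class
  \<open>C\<^sup>k\<close>: all directional derivatives are again of class \<open>C\<^sup>k\<^sup>-\<^sup>1\<close>.\<close>

fun C_on :: "nat \<Rightarrow> 'a::real_normed_vector set \<Rightarrow> ('a \<Rightarrow> 'b::real_normed_vector) \<Rightarrow> bool" where
  "C_on 0 S f \<longleftrightarrow> continuous_on S f"
| "C_on (Suc k) S f \<longleftrightarrow> (\<forall>x\<in>S. f differentiable (at x)) \<and>
     (\<forall>v. C_on k S (\<lambda>x. frechet_derivative f (at x) v))"

definition smooth_on :: "'a::real_normed_vector set \<Rightarrow> ('a \<Rightarrow> 'b::real_normed_vector) \<Rightarrow> bool" where
  "smooth_on S f \<longleftrightarrow> (\<forall>k. C_on k S f)"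


section \<open>Smooth manifolds\<close>

text \<open>A chart is a pair of its domain and its coordinate map; the values of the coordinate map
  outside the domain are irrelevant. The model space \<open>\<real>\<^sup>n\<close> is any finite-dimensional normed
  space (rather than a type of class \<open>euclidean_space\<close>), so that dimension 0 is included.
  The atlas need not be maximal.\<close>

type_synonym ('a, 'e) chart = "'a set \<times> ('a \<Rightarrow> 'e)"

locale smooth_manifold =
  fixes X :: "'a topology" and A :: "('a, 'e::real_normed_vector) chart set"
  assumes finite_dimensional: "\<exists>B::'e set. finite B \<and> span B = UNIV"
    and Hausdorff: "Hausdorff_space X"
    and second_countable: "second_countable X"
    and chart_domain: "(U, \<phi>) \<in> A \<Longrightarrow> openin X U"
    and chart_image: "(U, \<phi>) \<in> A \<Longrightarrow> open (\<phi> ` U)"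
    and chart_homeomorphic:
          "(U, \<phi>) \<in> A \<Longrightarrow> homeomorphic_map (subtopology X U) (top_of_set (\<phi> ` U)) \<phi>"
    and charts_cover: "x \<in> topspace X \<Longrightarrow> \<exists>(U, \<phi>)\<in>A. x \<in> U"
    and charts_compatible: "(U, \<phi>) \<in> A \<Longrightarrow> (V, \<psi>) \<in> A \<Longrightarrow>
          smooth_on (\<phi> ` (U \<inter> V)) (\<psi> \<circ> inv_into U \<phi>)"

text \<open>Smoothness of \<open>f\<close> on an open subset \<open>S\<close> of the manifold \<open>(X, A)\<close>, with values in \<open>(Y, B)\<close>.\<close>

definition smooth_map_on ::
  "'a topology \<Rightarrow> ('a, 'd::real_normed_vector) chart set \<Rightarrow> 'a set \<Rightarrow>
   'b topology \<Rightarrow> ('b, 'e::real_normed_vector) chart set \<Rightarrow> ('a \<Rightarrow> 'b) \<Rightarrow> bool" where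
  "smooth_map_on X A S Y B f \<longleftrightarrow> continuous_map (subtopology X S) Y f \<and>
     (\<forall>(U, \<phi>)\<in>A. \<forall>(V, \<psi>)\<in>B.
        smooth_on (\<phi> ` {x \<in> U \<inter> S. f x \<in> V}) (\<psi> \<circ> f \<circ> inv_into U \<phi>))"

definition prod_atlas ::
  "('a, 'd) chart set \<Rightarrow> ('b, 'e) chart set \<Rightarrow> ('a \<times> 'b, 'd \<times> 'e) chart set" where
  "prod_atlas A B = {(U \<times> V, map_prod \<phi> \<psi>) | U \<phi> V \<psi>. (U, \<phi>) \<in> A \<and> (V, \<psi>) \<in> B}"


section \<open>Lie groups and smooth actions\<close>

locale lie_group = group G + smooth_manifold T A
  for G :: "('g, 'z) monoid_scheme" (structure)
    and T :: "'g topology" and A :: "('g, 'k::real_normed_vector) chart set" +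
  assumes topspace_eq_carrier: "topspace T = carrier G"
    and smooth_mult: "smooth_map_on (prod_topology T T) (prod_atlas A A) (carrier G \<times> carrier G)
          T A (\<lambda>(g, h). g \<otimes> h)"
    and smooth_inv: "smooth_map_on T A (carrier G) T A (\<lambda>g. inv g)"

locale lie_group_action =
  lie_group G T A + manifold: smooth_manifold X B + group_action G "topspace X" act
  for G :: "('g, 'z) monoid_scheme" (structure)
    and T :: "'g topology" and A :: "('g, 'k::real_normed_vector) chart set"
    and X :: "'a topology" and B :: "('a, 'e::real_normed_vector) chart set"
    and act :: "'g \<Rightarrow> 'a \<Rightarrow> 'a" +
  assumes smooth_action: "smooth_map_on (prod_topology T X) (prod_atlas A B)
          (carrier G \<times> topspace X) X B (\<lambda>(g, x). act g x)"

definition free_action_on :: "('g, 'z) monoid_scheme \<Rightarrow> ('g \<Rightarrow> 'a \<Rightarrow> 'a) \<Rightarrow> 'a set \<Rightarrow> bool" where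
  "free_action_on G act U \<longleftrightarrow> (\<forall>x\<in>U. stabilizer G act x = {\<one>\<^bsub>G\<^esub>})"

text \<open>The orbit of \<open>x\<close> is an immersed submanifold whose dimension is the (constant) rank of the
  orbit map \<open>g \<mapsto> g \<cdot> x\<close>, computed here at the identity in a chart \<open>(W, \<phi>)\<close> of the group around
  the identity and a chart \<open>(V, \<psi>)\<close> around \<open>x\<close>.\<close>

definition orbit_dim ::
  "('g, 'z) monoid_scheme \<Rightarrow> ('g \<Rightarrow> 'a \<Rightarrow> 'a) \<Rightarrow> ('g, 'k::real_normed_vector) chart \<Rightarrow>
   ('a, 'e::real_normed_vector) chart \<Rightarrow> 'a \<Rightarrow> nat" where
  "orbit_dim G act = (\<lambda>(W, \<phi>) (V, \<psi>) x.
     dim (range (frechet_derivative (\<lambda>t. \<psi> (act (inv_into W \<phi> t) x)) (at (\<phi> \<one>\<^bsub>G\<^esub>)))))"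

text \<open>Connectedness is taken in the topology of the manifold. This is implied by connectedness
  in the intrinsic topology of the orbit.\<close>

definition regular_action_on ::
  "('g, 'z) monoid_scheme \<Rightarrow> ('g, 'k::real_normed_vector) chart set \<Rightarrow>
   'a topology \<Rightarrow> ('a, 'e::real_normed_vector) chart set \<Rightarrow> ('g \<Rightarrow> 'a \<Rightarrow> 'a) \<Rightarrow> 'a set \<Rightarrow> bool" where
  "regular_action_on G A X B act U \<longleftrightarrow>
     (\<exists>d. \<forall>x\<in>U. \<forall>(W, \<phi>)\<in>A. \<forall>(V, \<psi>)\<in>B. \<one>\<^bsub>G\<^esub> \<in> W \<and> x \<in> V \<longrightarrow>
        orbit_dim G act (W, \<phi>) (V, \<psi>) x = d) \<and>
     (\<forall>x\<in>U. \<forall>N. openin X N \<and> x \<in> N \<longrightarrow>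
        (\<exists>N'. openin X N' \<and> x \<in> N' \<and> N' \<subseteq> N \<and>
           (\<forall>y\<in>topspace X. connectedin X (N' \<inter> orbit G act y))))"

text \<open>\<open>U\<close> is the open set on which the frame is defined. It need not be invariant, so
  equivariance is required whenever both \<open>x\<close> and \<open>g \<cdot> x\<close> belong to \<open>U\<close>.\<close>

definition right_moving_frame ::
  "('g, 'z) monoid_scheme \<Rightarrow> 'g topology \<Rightarrow> ('g, 'k::real_normed_vector) chart set \<Rightarrow>
   'a topology \<Rightarrow> ('a, 'e::real_normed_vector) chart set \<Rightarrow> ('g \<Rightarrow> 'a \<Rightarrow> 'a) \<Rightarrow> 'a set \<Rightarrow>
   ('a \<Rightarrow> 'g) \<Rightarrow> bool" where
  "right_moving_frame G T A X B act U \<rho> \<longleftrightarrow> smooth_map_on X B U T A \<rho> \<and>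
     (\<forall>g\<in>carrier G. \<forall>x\<in>U. act g x \<in> U \<longrightarrow> \<rho> (act g x) = \<rho> x \<otimes>\<^bsub>G\<^esub> inv\<^bsub>G\<^esub> g)"


section \<open>Rational functions\<close>

text \<open>\<open>f\<close> is, on \<open>S\<close>, a rational function of the coordinates \<open>c\<close> without poles in \<open>S\<close>.
  For vector-valued \<open>f\<close> this says that all components are rational (with a common denominator).\<close>

definition rational_on :: "('a \<Rightarrow> 'c::real_normed_vector) \<Rightarrow> 'a set \<Rightarrow>
    ('a \<Rightarrow> 'v::real_normed_vector) \<Rightarrow> bool" where
  "rational_on c S f \<longleftrightarrow> (\<exists>p q. polynomial_function p \<and> real_polynomial_function q \<and>
     (\<forall>x\<in>S. q (c x) \<noteq> 0 \<and> f x = p (c x) /\<^sub>R q (c x)))"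

text \<open>The group \<open>\<F>(U)\<^sup>\<times>\<close>. Since it is closed under inverses, its elements have neither zeros nor
  poles in \<open>U\<close>.\<close>

definition rational_units :: "('a \<Rightarrow> 'e::real_normed_vector) \<Rightarrow> 'a set \<Rightarrow> ('a \<Rightarrow> real) set" where
  "rational_units \<psi> U = {f. rational_on \<psi> U f \<and> (\<forall>x\<in>U. f x \<noteq> 0)}"


section \<open>Multipliers\<close>

text \<open>\<open>D\<close> is the set of pairs \<open>(g, x)\<close> at which the function is defined; the identities are
  required wherever all of their terms are defined. A function defined on all of \<open>G \<times> U\<close> is the
  case \<open>D = carrier G \<times> U\<close>, whereas \<open>f(g \<cdot> x) / f(x)\<close> with \<open>f\<close> defined on \<open>U\<close> lives on
  \<open>action_domain\<close>; the two sets agree if \<open>U\<close> is invariant.\<close>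

definition action_domain ::
  "('g, 'z) monoid_scheme \<Rightarrow> ('g \<Rightarrow> 'a \<Rightarrow> 'a) \<Rightarrow> 'a set \<Rightarrow> ('g \<times> 'a) set" where
  "action_domain G act U = {(g, x). g \<in> carrier G \<and> x \<in> U \<and> act g x \<in> U}"

definition multiplier ::
  "('g, 'z) monoid_scheme \<Rightarrow> ('g \<Rightarrow> 'a \<Rightarrow> 'a) \<Rightarrow> ('g \<times> 'a) set \<Rightarrow> ('g \<Rightarrow> 'a \<Rightarrow> real) \<Rightarrow> bool" where
  "multiplier G act D \<mu> \<longleftrightarrow>
     (\<forall>(g, x)\<in>D. \<mu> g x \<noteq> 0) \<and>
     (\<forall>g\<in>carrier G. \<forall>h\<in>carrier G. \<forall>x.
        (g \<otimes>\<^bsub>G\<^esub> h, x) \<in> D \<and> (g, act h x) \<in> D \<and> (h, x) \<in> D \<longrightarrow>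
        \<mu> (g \<otimes>\<^bsub>G\<^esub> h) x = \<mu> g (act h x) * \<mu> h x) \<and>
     (\<forall>x. (\<one>\<^bsub>G\<^esub>, x) \<in> D \<longrightarrow> \<mu> \<one>\<^bsub>G\<^esub> x = 1)"

definition d1 ::
  "('g, 'z) monoid_scheme \<Rightarrow> ('g \<Rightarrow> 'a \<Rightarrow> 'a) \<Rightarrow> ('g \<Rightarrow> 'a \<Rightarrow> real) \<Rightarrow> 'g \<Rightarrow> 'g \<Rightarrow> 'a \<Rightarrow> real" where
  "d1 G act c g1 g2 x = c g1 (act g2 x) * c g2 x / c (g1 \<otimes>\<^bsub>G\<^esub> g2) x"

definition one_cocycle ::
  "('g, 'z) monoid_scheme \<Rightarrow> ('g \<Rightarrow> 'a \<Rightarrow> 'a) \<Rightarrow> ('g \<times> 'a) set \<Rightarrow> ('g \<Rightarrow> 'a \<Rightarrow> real) \<Rightarrow> bool" where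
  "one_cocycle G act D c \<longleftrightarrow>
     (\<forall>(g, x)\<in>D. c g x \<noteq> 0) \<and>
     (\<forall>g1\<in>carrier G. \<forall>g2\<in>carrier G. \<forall>x.
        (g1 \<otimes>\<^bsub>G\<^esub> g2, x) \<in> D \<and> (g1, act g2 x) \<in> D \<and> (g2, x) \<in> D \<longrightarrow>
        d1 G act c g1 g2 x = 1)"

end

theory Submission
  imports Defs
begin

text \<open>Part (i) is a telescoping product: \<open>f (g h x) / f x\<close> is \<open>f (g h x) / f (h x)\<close> times
  \<open>f (h x) / f x\<close>.

  For part (ii), a frame trivialises every cocycle. Equivariance says
  \<open>\<rho> (g x) g = \<rho> x\<close>, so the multiplier identity for the product \<open>\<rho> (g x) g\<close> at \<open>x\<close> reads
  \<open>\<mu> (\<rho> x) x = \<mu> (\<rho> (g x)) (g x) * \<mu> g x\<close>. Hence \<open>f x = 1 / \<mu> (\<rho> x) x\<close> satisfies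
  \<open>\<mu> g x = f (g x) / f x\<close>, where \<open>\<rho> x\<close> moves \<open>x\<close> to the cross-section: \<open>f\<close> is the reciprocal of
  the factor picked up on the way there (\<open>multiplier_eq_frame_quotient\<close>).

  The rest is the claim that these functions are rational. Everything reduces to the fact that
  substituting rational functions into a rational function gives a rational function
  (\<open>rational_on_trans\<close>), applied in (i) to \<open>f\<close> and the coordinates of \<open>g x\<close>, and in (ii) to
  \<open>\<mu>\<close> and the pair formed by the group parameters of \<open>\<rho> x\<close> and the coordinates of \<open>x\<close>.\<close>

section \<open>Closure properties of rational functions\<close>

lemma rational_on_realE:
  fixes F :: "'a \<Rightarrow> real"
  assumes "rational_on c S F"
  obtains p q where "real_polynomial_function p" "real_polynomial_function q"
    "\<And>x. x \<in> S \<Longrightarrow> q (c x) \<noteq> 0" "\<And>x. x \<in> S \<Longrightarrow> F x = p (c x) / q (c x)"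
  using assms unfolding rational_on_def real_polynomial_function_eq[symmetric]
  by (force simp: divide_inverse_commute)

lemma rational_on_realI:
  fixes F :: "'a \<Rightarrow> real"
  assumes "real_polynomial_function p" "real_polynomial_function q"
    "\<And>x. x \<in> S \<Longrightarrow> q (c x) \<noteq> 0" "\<And>x. x \<in> S \<Longrightarrow> F x = p (c x) / q (c x)"
  shows "rational_on c S F"
  unfolding rational_on_def real_polynomial_function_eq[symmetric]
  using assms by (force simp: divide_inverse_commute)

lemma rational_on_const: "rational_on c S (\<lambda>x. k :: real)"
  by (rule rational_on_realI[where p = "\<lambda>_. k" and q = "\<lambda>_. 1"]) auto

lemma rational_on_add:
  fixes F H :: "'a \<Rightarrow> real"
  assumes "rational_on c S F" "rational_on c S H"
  shows "rational_on c S (\<lambda>x. F x + H x)"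
proof -
  from assms(1) obtain p q where F: "real_polynomial_function p" "real_polynomial_function q"
    "\<And>x. x \<in> S \<Longrightarrow> q (c x) \<noteq> 0" "\<And>x. x \<in> S \<Longrightarrow> F x = p (c x) / q (c x)"
    by (rule rational_on_realE) blast
  from assms(2) obtain r s where H: "real_polynomial_function r" "real_polynomial_function s"
    "\<And>x. x \<in> S \<Longrightarrow> s (c x) \<noteq> 0" "\<And>x. x \<in> S \<Longrightarrow> H x = r (c x) / s (c x)"
    by (rule rational_on_realE) blast
  show ?thesis
    by (rule rational_on_realI[where p = "\<lambda>y. p y * s y + r y * q y" and q = "\<lambda>y. q y * s y"])
      (use F H in \<open>auto simp: add_frac_eq intro: real_polynomial_function.intros\<close>)
qed

lemma rational_on_mult:
  fixes F H :: "'a \<Rightarrow> real"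
  assumes "rational_on c S F" "rational_on c S H"
  shows "rational_on c S (\<lambda>x. F x * H x)"
proof -
  from assms(1) obtain p q where F: "real_polynomial_function p" "real_polynomial_function q"
    "\<And>x. x \<in> S \<Longrightarrow> q (c x) \<noteq> 0" "\<And>x. x \<in> S \<Longrightarrow> F x = p (c x) / q (c x)"
    by (rule rational_on_realE) blast
  from assms(2) obtain r s where H: "real_polynomial_function r" "real_polynomial_function s"
    "\<And>x. x \<in> S \<Longrightarrow> s (c x) \<noteq> 0" "\<And>x. x \<in> S \<Longrightarrow> H x = r (c x) / s (c x)"
    by (rule rational_on_realE) blast
  show ?thesis
    by (rule rational_on_realI[where p = "\<lambda>y. p y * r y" and q = "\<lambda>y. q y * s y"])
      (use F H in \<open>auto intro: real_polynomial_function.intros\<close>)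
qed

lemma rational_on_divide:
  fixes F H :: "'a \<Rightarrow> real"
  assumes "rational_on c S F" "rational_on c S H" and nz: "\<And>x. x \<in> S \<Longrightarrow> H x \<noteq> 0"
  shows "rational_on c S (\<lambda>x. F x / H x)"
proof -
  from assms(2) obtain r s where H: "real_polynomial_function r" "real_polynomial_function s"
    "\<And>x. x \<in> S \<Longrightarrow> s (c x) \<noteq> 0" "\<And>x. x \<in> S \<Longrightarrow> H x = r (c x) / s (c x)"
    by (rule rational_on_realE) blast
  have "rational_on c S (\<lambda>x. 1 / H x)"
    by (rule rational_on_realI[where p = s and q = r]) (use H nz in auto)
  from rational_on_mult[OF assms(1) this] show ?thesis by simp
qed

lemma rational_on_coordinates: "rational_on c S c"
  unfolding rational_on_def
  by (rule exI[where x = "\<lambda>y. y"], rule exI[where x = "\<lambda>_. 1"])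
    (auto simp: polynomial_function_id)

lemma rational_on_linear:
  fixes f :: "'v::real_normed_vector \<Rightarrow> real"
  assumes "rational_on c S h" "bounded_linear f"
  shows "rational_on c S (\<lambda>x. f (h x))"
proof -
  obtain p q where h: "polynomial_function p" "real_polynomial_function q"
    "\<And>x. x \<in> S \<Longrightarrow> q (c x) \<noteq> 0 \<and> h x = p (c x) /\<^sub>R q (c x)"
    using assms(1) unfolding rational_on_def by blast
  interpret f: bounded_linear f by fact
  show ?thesis
    by (rule rational_on_realI[where p = "f \<circ> p" and q = q])
      (use h assms(2) in \<open>auto simp: polynomial_function_def f.scaleR divide_inverse_commute\<close>)
qed

text \<open>Bringing the two components to the common denominator \<open>q s\<close>. The numerator is tested
  against a linear functional \<open>f\<close>, which splits as \<open>f (u, v) = f (u, 0) + f (0, v)\<close>.\<close>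

lemma rational_on_Pair:
  assumes "rational_on c S h" "rational_on c S k"
  shows "rational_on c S (\<lambda>x. (h x, k x))"
proof -
  obtain p q where h: "polynomial_function p" "real_polynomial_function q"
    "\<And>x. x \<in> S \<Longrightarrow> q (c x) \<noteq> 0 \<and> h x = p (c x) /\<^sub>R q (c x)"
    using assms(1) unfolding rational_on_def by blast
  obtain r s where k: "polynomial_function r" "real_polynomial_function s"
    "\<And>x. x \<in> S \<Longrightarrow> s (c x) \<noteq> 0 \<and> k x = r (c x) /\<^sub>R s (c x)"
    using assms(2) unfolding rational_on_def by blast
  have "polynomial_function (\<lambda>y. (s y *\<^sub>R p y, q y *\<^sub>R r y))"
    unfolding polynomial_function_def
  proof (intro allI impI)
    fix f :: "'c \<times> 'd \<Rightarrow> real"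
    assume f: "bounded_linear f"
    then interpret f: bounded_linear f .
    have l: "bounded_linear (\<lambda>u. f (u, 0))" "bounded_linear (\<lambda>v. f (0, v))"
      by (auto intro!: bounded_linear_compose[OF f] bounded_linear_Pair bounded_linear_ident
          bounded_linear_zero)
    have "f (s y *\<^sub>R p y, q y *\<^sub>R r y) = s y * f (p y, 0) + q y * f (0, r y)" for y
      using f.add[of "s y *\<^sub>R (p y, 0)" "q y *\<^sub>R (0, r y)"]
      by (simp only: f.scaleR) simp
    moreover have "real_polynomial_function (\<lambda>y. f (p y, 0))"
        "real_polynomial_function (\<lambda>y. f (0, r y))"
      using h(1) k(1) l unfolding polynomial_function_def o_def by blast+
    ultimately show "real_polynomial_function (f \<circ> (\<lambda>y. (s y *\<^sub>R p y, q y *\<^sub>R r y)))"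
      using h(2) k(2) by (simp add: o_def real_polynomial_function.intros)
  qed
  moreover have "real_polynomial_function (\<lambda>y. q y * s y)"
    using h(2) k(2) by (rule real_polynomial_function.intros)
  moreover have "\<forall>x\<in>S. q (c x) * s (c x) \<noteq> 0 \<and>
      (h x, k x) = (s (c x) *\<^sub>R p (c x), q (c x) *\<^sub>R r (c x)) /\<^sub>R (q (c x) * s (c x))"
    using h(3) k(3) by (auto simp: field_simps)
  ultimately show ?thesis
    unfolding rational_on_def by (intro exI conjI)
qed

lemma rational_on_polynomial:
  assumes "real_polynomial_function P" "rational_on c S h"
  shows "rational_on c S (\<lambda>x. P (h x))"
  using assms(1)
proof induction
  case (linear f)
  with assms(2) show ?case by (rule rational_on_linear)
qed (auto intro: rational_on_const rational_on_add rational_on_mult)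

text \<open>Numerator and denominator of \<open>F\<close> become rational functions of \<open>c\<close>, and the denominator
  keeps its values, so it still has no zeros on \<open>S\<close> and the quotient can be formed.\<close>

lemma rational_on_trans:
  fixes F :: "'a \<Rightarrow> real"
  assumes "rational_on c S h" "rational_on h S F"
  shows "rational_on c S F"
proof -
  from assms(2) obtain p q where F: "real_polynomial_function p" "real_polynomial_function q"
    "\<And>x. x \<in> S \<Longrightarrow> q (h x) \<noteq> 0" "\<And>x. x \<in> S \<Longrightarrow> F x = p (h x) / q (h x)"
    by (rule rational_on_realE) blast
  have "rational_on c S (\<lambda>x. p (h x) / q (h x))"
    using F(1-3) by (intro rational_on_divide rational_on_polynomial[OF _ assms(1)])
  with F(4) show ?thesis
    unfolding rational_on_def by (metis (no_types, lifting))
qed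

lemma rational_on_precompose:
  assumes "rational_on d R F" "\<And>x. x \<in> S \<Longrightarrow> k x \<in> R"
  shows "rational_on (\<lambda>x. d (k x)) S (\<lambda>x. F (k x))"
  using assms unfolding rational_on_def by blast

section \<open>The cocycle identity\<close>

context group_action
begin

lemma multiplier_quotient:
  assumes "U \<subseteq> E" "\<And>x. x \<in> U \<Longrightarrow> f x \<noteq> 0"
  shows "multiplier G \<phi> (action_domain G \<phi> U) (\<lambda>g x. f (\<phi> g x) / f x)"
proof -
  have "\<phi> \<one> x = x" if "x \<in> U" for x
    using assms(1) that by (simp add: id_eq_one[symmetric] subset_iff)
  then show ?thesis
    using assms composition_rule
    by (auto simp: multiplier_def action_domain_def subset_iff)
qed

end

lemma multiplier_imp_one_cocycle:
  assumes "multiplier G act D \<mu>"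
  shows "one_cocycle G act D \<mu>"
  using assms unfolding multiplier_def one_cocycle_def d1_def
  by (fastforce simp: case_prod_unfold)

text \<open>The multiplier identity for the product \<open>\<rho> (g x) g = \<rho> x\<close> at \<open>x\<close>, solved for
  \<open>\<mu> g x\<close>. It is available because \<open>D\<close> contains the graph of the frame over both \<open>x\<close> and
  \<open>g x\<close>.\<close>

lemma (in group) multiplier_eq_frame_quotient:
  assumes \<mu>: "multiplier G act D \<mu>"
    and D: "D \<subseteq> carrier G \<times> U" "\<And>x. x \<in> U \<Longrightarrow> (\<rho> x, x) \<in> D"
    and equivariant: "\<rho> (act g x) = \<rho> x \<otimes> inv g"
    and gx: "(g, x) \<in> D" "act g x \<in> U"
  shows "\<mu> g x = \<mu> (\<rho> x) x / \<mu> (\<rho> (act g x)) (act g x)"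
proof -
  have x: "x \<in> U" "g \<in> carrier G" using D(1) gx(1) by auto
  have \<rho>: "\<rho> x \<in> carrier G" "\<rho> (act g x) \<in> carrier G"
    using D x(1) gx(2) by blast+
  have "\<rho> (act g x) \<otimes> g = \<rho> x"
    using \<rho>(1) x(2) by (simp add: equivariant m_assoc)
  then have "\<mu> (\<rho> x) x = \<mu> (\<rho> (act g x)) (act g x) * \<mu> g x"
    using \<mu> \<rho>(2) x D(2)[OF x(1)] D(2)[OF gx(2)] gx(1) unfolding multiplier_def by metis
  moreover have "\<mu> (\<rho> (act g x)) (act g x) \<noteq> 0"
    using \<mu> D(2)[OF gx(2)] unfolding multiplier_def by blast
  ultimately show ?thesis by simp
qed

section \<open>Multipliers are coboundaries\<close>

theorem theorem2:
  fixes G :: "('g, 'z) monoid_scheme"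
    and T :: "'g topology" and A :: "('g, 'k::real_normed_vector) chart set"
    and X :: "'a topology" and B :: "('a, 'e::real_normed_vector) chart set"
    and act :: "'g \<Rightarrow> 'a \<Rightarrow> 'a"
    and x0 :: 'a and U V :: "'a set" and \<psi> :: "'a \<Rightarrow> 'e"
    and W :: "'g set" and \<phi> :: "'g \<Rightarrow> 'k"
    and \<rho> :: "'a \<Rightarrow> 'g"
  assumes action: "lie_group_action G T A X B act"
    and nbhd: "openin X U" "x0 \<in> U"
    and free: "free_action_on G act U"
    and regular: "regular_action_on G A X B act U"
    and frame: "right_moving_frame G T A X B act U \<rho>"
    and coordinates: "(V, \<psi>) \<in> B" "U \<subseteq> V"
    and parameters: "(W, \<phi>) \<in> A" "\<rho> ` U \<subseteq> W"
    and frame_rational: "rational_on \<psi> U (\<lambda>x. \<phi> (\<rho> x))"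
  shows
    "(\<forall>f \<in> rational_units \<psi> U.
        multiplier G act (action_domain G act U) (\<lambda>g x. f (act g x) / f x) \<and>
        one_cocycle G act (action_domain G act U) (\<lambda>g x. f (act g x) / f x) \<and>
        (rational_on (map_prod \<phi> \<psi>) (action_domain G act U \<inter> W \<times> U) (\<lambda>(g, x). \<psi> (act g x)) \<longrightarrow>
         rational_on (map_prod \<phi> \<psi>) (action_domain G act U \<inter> W \<times> U)
           (\<lambda>(g, x). f (act g x) / f x)))
     \<and>
     (\<forall>D \<mu>. D \<subseteq> carrier G \<times> U \<and> (\<forall>x\<in>U. (\<rho> x, x) \<in> D) \<and>
        multiplier G act D \<mu> \<and>
        rational_on (map_prod \<phi> \<psi>) (D \<inter> W \<times> U) (\<lambda>(g, x). \<mu> g x) \<longrightarrow>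
        (\<exists>f \<in> rational_units \<psi> U. \<forall>(g, x)\<in>D. act g x \<in> U \<longrightarrow> \<mu> g x = f (act g x) / f x))"
proof (intro conjI ballI allI impI)
  interpret lie_group_action G T A X B act by fact
  have U: "U \<subseteq> topspace X" using nbhd(1) by (rule openin_subset)
  fix f assume f: "f \<in> rational_units \<psi> U"
  then have nz: "\<And>x. x \<in> U \<Longrightarrow> f x \<noteq> 0" and rat: "rational_on \<psi> U f"
    by (auto simp: rational_units_def)
  show m: "multiplier G act (action_domain G act U) (\<lambda>g x. f (act g x) / f x)"
    using U nz by (rule multiplier_quotient)
  show "one_cocycle G act (action_domain G act U) (\<lambda>g x. f (act g x) / f x)"
    using m by (rule multiplier_imp_one_cocycle)
  let ?S = "action_domain G act U \<inter> W \<times> U"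
  assume act_rat: "rational_on (map_prod \<phi> \<psi>) ?S (\<lambda>(g, x). \<psi> (act g x))"
  have "rational_on (\<lambda>z. \<psi> (act (fst z) (snd z))) ?S (\<lambda>z. f (act (fst z) (snd z)))"
    using rat by (rule rational_on_precompose) (auto simp: action_domain_def)
  then have num: "rational_on (map_prod \<phi> \<psi>) ?S (\<lambda>z. f (act (fst z) (snd z)))"
    by (rule rational_on_trans[OF act_rat[unfolded case_prod_unfold]])
  have "rational_on (map_prod \<phi> \<psi>) ?S (\<lambda>z. \<psi> (snd z))"
    unfolding rational_on_def
    by (rule exI[where x = snd], rule exI[where x = "\<lambda>_. 1"])
      (auto intro: polynomial_function_bounded_linear bounded_linear_snd)
  moreover have "rational_on (\<lambda>z. \<psi> (snd z)) ?S (\<lambda>z. f (snd z))"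
    using rat by (rule rational_on_precompose) auto
  ultimately have den: "rational_on (map_prod \<phi> \<psi>) ?S (\<lambda>z. f (snd z))"
    by (rule rational_on_trans)
  show "rational_on (map_prod \<phi> \<psi>) ?S (\<lambda>(g, x). f (act g x) / f x)"
    using rational_on_divide[OF num den] nz by (auto simp: case_prod_unfold)
next
  interpret lie_group_action G T A X B act by fact
  fix D \<mu>
  assume "D \<subseteq> carrier G \<times> U \<and> (\<forall>x\<in>U. (\<rho> x, x) \<in> D) \<and> multiplier G act D \<mu> \<and>
    rational_on (map_prod \<phi> \<psi>) (D \<inter> W \<times> U) (\<lambda>(g, x). \<mu> g x)"
  then have D: "D \<subseteq> carrier G \<times> U" and graph: "\<And>x. x \<in> U \<Longrightarrow> (\<rho> x, x) \<in> D"
    and \<mu>: "multiplier G act D \<mu>"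
    and \<mu>_rat: "rational_on (map_prod \<phi> \<psi>) (D \<inter> W \<times> U) (\<lambda>(g, x). \<mu> g x)"
    by auto
  define f where "f x = 1 / \<mu> (\<rho> x) x" for x
  have nz: "\<mu> (\<rho> x) x \<noteq> 0" if "x \<in> U" for x
    using \<mu> graph[OF that] unfolding multiplier_def by blast
  \<comment> \<open>Restrict \<open>\<mu>\<close> to the graph of the frame, then substitute the rational parameters of \<open>\<rho> x\<close>.\<close>
  have "rational_on (\<lambda>x. map_prod \<phi> \<psi> (\<rho> x, x)) U (\<lambda>x. case (\<rho> x, x) of (g, x) \<Rightarrow> \<mu> g x)"
    using \<mu>_rat by (rule rational_on_precompose) (use graph parameters(2) in auto)
  then have "rational_on (\<lambda>x. (\<phi> (\<rho> x), \<psi> x)) U (\<lambda>x. \<mu> (\<rho> x) x)"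
    by simp
  with rational_on_Pair[OF frame_rational rational_on_coordinates]
  have "rational_on \<psi> U (\<lambda>x. \<mu> (\<rho> x) x)"
    by (rule rational_on_trans)
  then have "rational_on \<psi> U f"
    unfolding f_def using nz by (intro rational_on_divide rational_on_const)
  then have "f \<in> rational_units \<psi> U"
    using nz by (simp add: rational_units_def f_def)
  moreover have "\<mu> g x = f (act g x) / f x" if gx: "(g, x) \<in> D" "act g x \<in> U" for g x
  proof -
    have "\<rho> (act g x) = \<rho> x \<otimes>\<^bsub>G\<^esub> inv\<^bsub>G\<^esub> g"
      using frame D gx unfolding right_moving_frame_def by blast
    from multiplier_eq_frame_quotient[OF \<mu> D graph this gx]
    show ?thesis by (simp add: f_def)
  qed
  ultimately show "\<exists>f \<in> rational_units \<psi> U.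
      \<forall>(g, x)\<in>D. act g x \<in> U \<longrightarrow> \<mu> g x = f (act g x) / f x"
    by blast
qed

end
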